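(* For every Lebesgue measurable $f,g:\mathbb{R}\to\{-1,1\}$ we have $$\int_{\mathbb{R}}\int_{\mathbb{R}} f(x)g(y)\exp\left(-\frac{x^2+y^2}{2}\right)\sin(xy)\,dx\,dy\le\int_{\mathbb{R}}\int_{\mathbb{R}}\mathrm{sign}(x)\,\mathrm{sign}(y)\exp\left(-\frac{x^2+y^2}{2}\right)\sin(xy)\,dx\,dy=2\sqrt{2}\log\left(1+\sqrt{2}\right).$$ Moreover, equality in the inequality $$\int_{\mathbb{R}}\int_{\mathbb{R}} f(x)g(y)\exp\left(-\frac{x^2+y^2}{2}\right)\sin(xy)\,dx\,dy\le 2\sqrt{2}\log\left(1+\sqrt{2}\right)$$ is attained only when $f(x)=g(x)=\mathrm{sign}(x)$ for almost every $x$, or $f(x)=g(x)=-\mathrm{sign}(x)$ for almost every $x$.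
   Context: Here $\mathrm{sign}(x)$ is $1$ for $x>0$ and $-1$ for $x<0$ (the value at $0$ is immaterial), and $\log$ is the natural logarithm. *)

theory Defs
  imports "HOL-Analysis.Analysis"
begin

text \<open>
  An iterated integral, inner variable \<open>x\<close>. For Lebesgue measurable bounded \<open>f\<close> and \<open>g\<close> both
  integrands are integrable, by comparison with a Gaussian, so the convention that Bochner
  integrals of non-integrable functions are \<open>0\<close> plays no role.
\<close>

definition gauss_sin_form :: "(real \<Rightarrow> real) \<Rightarrow> (real \<Rightarrow> real) \<Rightarrow> real" where
  "gauss_sin_form f g =
     (LINT y|lebesgue. (LINT x|lebesgue.
        f x * g y * exp (- ((x\<^sup>2 + y\<^sup>2) / 2)) * sin (x * y)))"

end

theory Submission
  imports Defs "HOL-Probability.Distributions"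
begin

text \<open>
  Write \<open>K x y = exp (- (x\<^sup>2 + y\<^sup>2) / 2) * sin (x * y)\<close>. Since the Gaussian sine transform of \<open>sgn\<close> has
  the sign of its argument, \<open>\<integral> K x y * sgn y dy = sgn x * w x\<close> with \<open>w > 0\<close> off the origin. So \<open>sgn\<close> is
  an eigenfunction with eigenvalue \<open>1\<close> of the operator on \<open>L\<^sup>2(w dx)\<close> with kernel
  \<open>K x y / (w x * w y)\<close>, and functions with values in \<open>{-1, 1}\<close> have the same norm there as \<open>sgn\<close>.
  It therefore suffices that the operator has norm less than \<open>1\<close> on the orthogonal complement of
  \<open>sgn\<close>, which holds because its squared Hilbert--Schmidt norm is less than \<open>2\<close>. By Jensen's
  inequality \<open>w x \<ge> 2 * \<bar>x\<bar> * exp (- 5 * x\<^sup>2 / 6)\<close>, which bounds the squared norm by an explicit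
  integral with value \<open>(arsinh 6)\<^sup>2 / 4 < 2\<close>.
\<close>

section \<open>The Gaussian sine transform of the sign function\<close>

definition gauss :: "real \<Rightarrow> real" where
  "gauss x = exp (- (x\<^sup>2 / 2))"

definition sine_transform :: "real \<Rightarrow> real" where
  "sine_transform k = (LINT x|lborel. sgn x * gauss x * sin (k * x))"

lemma gauss_pos [simp]: "0 < gauss x"
  by (simp add: gauss_def)

lemma gauss_nonneg [simp]: "0 \<le> gauss x"
  by (simp add: gauss_def)

lemma gauss_measurable [measurable]: "gauss \<in> borel_measurable borel"
  unfolding gauss_def by measurable

lemma sgn_measurable [measurable]: "(sgn :: real \<Rightarrow> real) \<in> borel_measurable borel"
  unfolding sgn_if[abs_def] by measurable

lemma std_normal_density_gauss: "gauss x = sqrt (2 * pi) * std_normal_density x"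
  by (simp add: gauss_def std_normal_density_def)

lemma integrable_gauss_moment: "integrable lborel (\<lambda>x. \<bar>x\<bar> ^ n * gauss x)"
  using integrable_mult_right[OF integrable_std_normal_moment_abs[of n], of "sqrt (2 * pi)"]
  by (simp add: std_normal_density_gauss mult_ac)

lemma integrable_gauss: "integrable lborel gauss"
  using integrable_gauss_moment[of 0] by simp

lemma integrable_abs_gauss: "integrable lborel (\<lambda>x. \<bar>x\<bar> * gauss x)"
  using integrable_gauss_moment[of 1] by simp

lemma integrable_square_gauss: "integrable lborel (\<lambda>x. x\<^sup>2 * gauss x)"
  using integrable_gauss_moment[of 2] by simp

lemma integral_abs_gauss: "(LINT x|lborel. \<bar>x\<bar> * gauss x) = 2"
proof -
  have "(LINT x|lborel. \<bar>x\<bar> * gauss x) = (LINT x|lborel. sqrt (2 * pi) * (std_normal_density x * \<bar>x\<bar> ^ (2 * 0 + 1)))"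
    by (rule Bochner_Integration.integral_cong) (auto simp: std_normal_density_gauss)
  also have "\<dots> = sqrt (2 * pi) * sqrt (2 / pi)"
    by (subst integral_mult_right_zero, subst integral_std_normal_moment_abs_odd) simp
  also have "\<dots> = 2"
    by (simp add: real_sqrt_mult real_sqrt_divide)
  finally show ?thesis .
qed

lemma integrable_scaled_gauss:
  assumes "c > 0"
  shows "integrable lborel (\<lambda>x. gauss (c * x))"
  using lborel_integrable_real_affine[OF integrable_gauss, of c 0] assms by simp

lemma integral_abs_scaled_gauss:
  assumes "c > 0"
  shows "(LINT x|lborel. \<bar>x\<bar> * gauss (c * x)) = 2 / c\<^sup>2"
proof -
  have "2 = (LINT x|lborel. \<bar>x\<bar> * gauss x)"
    by (simp add: integral_abs_gauss)
  also have "\<dots> = c * (LINT x|lborel. \<bar>c * x\<bar> * gauss (c * x))"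
    using lborel_integral_real_affine[of c "\<lambda>x. \<bar>x\<bar> * gauss x" 0] assms by simp
  also have "(LINT x|lborel. \<bar>c * x\<bar> * gauss (c * x)) = (LINT x|lborel. c * (\<bar>x\<bar> * gauss (c * x)))"
    using assms by (simp add: abs_mult mult_ac)
  also have "\<dots> = c * (LINT x|lborel. \<bar>x\<bar> * gauss (c * x))"
    by simp
  finally show ?thesis
    using assms by (simp add: field_simps power2_eq_square)
qed

lemma gauss_deriv: "(gauss has_real_derivative - x * gauss x) (at x within S)"
  unfolding gauss_def by (auto intro!: derivative_eq_intros)

lemma gauss_tendsto_0: "(gauss \<longlongrightarrow> 0) at_top"
proof -
  have "LIM x at_top. 1 / 2 * x\<^sup>2 :> (at_top :: real filter)"
    by (rule filterlim_tendsto_pos_mult_at_top[OF tendsto_const])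
       (auto intro!: filterlim_pow_at_top filterlim_ident)
  then show ?thesis
    unfolding gauss_def
    by (intro filterlim_compose[OF exp_at_bot]) (simp add: filterlim_uminus_at_top)
qed

lemma isCont_gauss [continuous_intros]: "isCont gauss x"
  unfolding gauss_def by (intro continuous_intros) auto

lemma integrable_sine_transform: "integrable lborel (\<lambda>x. sgn x * gauss x * sin (k * x))"
  by (rule Bochner_Integration.integrable_bound[OF integrable_gauss])
     (auto simp: abs_mult sgn_if intro: mult_left_le)

lemma integrable_abs_gauss_cos: "integrable lborel (\<lambda>x. \<bar>x\<bar> * gauss x * cos (k * x))"
  by (rule Bochner_Integration.integrable_bound[OF integrable_abs_gauss])
     (auto simp: abs_mult intro!: mult_left_le AE_I2)

text \<open>Integration by parts: on the positive half-line \<open>- gauss x * cos (k * x)\<close>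
  is an antiderivative of \<open>?g\<close>, with boundary values -1 at 0 and 0 at infinity. The
  integrand \<open>?h\<close> is even, so the whole line contributes twice as much.\<close>

lemma integral_abs_gauss_cos:
  "(LINT x|lborel. \<bar>x\<bar> * gauss x * cos (k * x)) = 2 - k * sine_transform k"
proof -
  let ?g = "\<lambda>x. gauss x * (x * cos (k * x) + k * sin (k * x))"
  let ?h = "\<lambda>x. \<bar>x\<bar> * gauss x * cos (k * x) + k * (sgn x * gauss x * sin (k * x))"
  note i1 = integrable_abs_gauss_cos[of k] and i2 = integrable_sine_transform[of k]
  have ih: "integrable lborel ?h"
    using i1 i2 by simp
  have si: "set_integrable lborel {0<..} ?g"
    unfolding set_integrable_def
    by (rule Bochner_Integration.integrable_bound[OF ih])
       (auto simp: sgn_if algebra_simps indicator_def)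
  have "(LBINT x=ereal 0..\<infinity>. ?g x) = 0 - (- 1)"
  proof (rule interval_integral_FTC_integrable[where F = "\<lambda>x. - gauss x * cos (k * x)"])
    show "((\<lambda>x. - gauss x * cos (k * x)) has_vector_derivative ?g x) (at x)" for x
      unfolding has_real_derivative_iff_has_vector_derivative[symmetric]
      by (auto intro!: derivative_eq_intros gauss_deriv simp: algebra_simps)
    show "isCont ?g x" for x by (intro continuous_intros)
    show "set_integrable lborel (einterval (ereal 0) \<infinity>) ?g"
      using si by (simp add: einterval_def greaterThan_def)
    show "(((\<lambda>x. - gauss x * cos (k * x)) \<circ> real_of_ereal) \<longlongrightarrow> - 1) (at_right (ereal 0))"
      unfolding ereal_tendsto_simps
    proof -
      have "isCont (\<lambda>x. - gauss x * cos (k * x)) 0" by (intro continuous_intros)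
      then show "((\<lambda>x. - gauss x * cos (k * x)) \<longlongrightarrow> - 1) (at_right 0)"
        by (auto simp: isCont_def gauss_def intro: filterlim_mono[OF _ order_refl at_le])
    qed
    show "(((\<lambda>x. - gauss x * cos (k * x)) \<circ> real_of_ereal) \<longlongrightarrow> 0) (at_left \<infinity>)"
      unfolding ereal_tendsto_simps
      by (rule Lim_null_comparison[OF _ gauss_tendsto_0]) (auto simp: abs_mult mult_left_le)
  qed simp
  then have "(LINT x:{0<..}|lborel. ?g x) = 1"
    by (simp add: interval_lebesgue_integral_def einterval_def greaterThan_def)
  then have "has_bochner_integral lborel (\<lambda>x. indicator {0<..} x *\<^sub>R ?g x) 1"
    using si by (simp add: has_bochner_integral_iff set_integrable_def set_lebesgue_integral_def)
  then have "has_bochner_integral lborel (\<lambda>x. indicator {0..} x *\<^sub>R ?h x) 1"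
    by (rule has_bochner_integralI_AE)
       (use AE_lborel_singleton[of "0::real"] in \<open>auto simp: indicator_def sgn_if algebra_simps\<close>)
  then have "has_bochner_integral lborel ?h (2 *\<^sub>R 1)"
    by (rule has_bochner_integral_even_function) (auto simp: gauss_def sgn_if)
  then have "integral\<^sup>L lborel ?h = 2"
    by (simp add: has_bochner_integral_iff)
  then show ?thesis
    using i1 i2 by (simp add: sine_transform_def)
qed

text \<open>The remainder is quadratic in \<open>b\<close> uniformly in \<open>a\<close>, so against
  \<open>gauss\<close> it has an integrable majorant. This justifies differentiating
  \<open>sine_transform\<close> under the integral sign.\<close>

lemma sin_add_taylor_bound: "\<bar>sin (a + b) - sin a - b * cos a\<bar> \<le> b\<^sup>2" for a b :: real
proof -
  have 1: "\<bar>sin b - b\<bar> \<le> b\<^sup>2 / 2"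
    using Maclaurin_sin_bound[of b 2] by (simp add: numeral_2_eq_2 sin_coeff_def)
  have "\<bar>sin (b / 2)\<bar> \<le> \<bar>b / 2\<bar>" by (rule abs_sin_x_le_abs_x)
  then have "(sin (b / 2))\<^sup>2 \<le> (b / 2)\<^sup>2" by (rule abs_le_square_iff[THEN iffD1])
  moreover have "cos b = 1 - 2 * (sin (b / 2))\<^sup>2"
    using cos_double_sin[of "b / 2"] by simp
  ultimately have 2: "\<bar>cos b - 1\<bar> \<le> b\<^sup>2 / 2"
    by (simp add: power_divide)
  have "sin (a + b) - sin a - b * cos a = sin a * (cos b - 1) + cos a * (sin b - b)"
    by (simp add: sin_add algebra_simps)
  also have "\<bar>\<dots>\<bar> \<le> \<bar>sin a\<bar> * \<bar>cos b - 1\<bar> + \<bar>cos a\<bar> * \<bar>sin b - b\<bar>"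
    by (metis abs_mult abs_triangle_ineq)
  also have "\<dots> \<le> 1 * (b\<^sup>2 / 2) + 1 * (b\<^sup>2 / 2)"
    by (intro add_mono mult_mono 1 2) auto
  finally show ?thesis by simp
qed

text \<open>Differentiation under the integral sign produces a cosine integral, which integration by
  parts expresses through the transform itself. The resulting linear equation is that of a rescaled
  Dawson function.\<close>

lemma sine_transform_deriv:
  "(sine_transform has_real_derivative 2 - k * sine_transform k) (at k)"
proof -
  let ?Q = "LINT x|lborel. \<bar>x\<bar> * gauss x * cos (k * x)"
  define C where "C = (LINT x|lborel. x\<^sup>2 * gauss x)"
  have bound: "\<bar>sine_transform (k + d) - sine_transform k - d * ?Q\<bar> \<le> d\<^sup>2 * C" for d
  proof -
    let ?r = "\<lambda>x. sgn x * gauss x * sin ((k + d) * x) - sgn x * gauss x * sin (k * x)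
                 - d * (\<bar>x\<bar> * gauss x * cos (k * x))"
    have eq: "sine_transform (k + d) - sine_transform k - d * ?Q = (LINT x|lborel. ?r x)"
      unfolding sine_transform_def
      by (simp add: integrable_sine_transform integrable_abs_gauss_cos)
    have "norm (LINT x|lborel. ?r x) \<le> (LINT x|lborel. d\<^sup>2 * (x\<^sup>2 * gauss x))"
    proof (rule Bochner_Integration.integral_norm_bound_integral)
      show "integrable lborel ?r"
        by (intro Bochner_Integration.integrable_diff integrable_mult_right
              integrable_sine_transform integrable_abs_gauss_cos)
      show "integrable lborel (\<lambda>x. d\<^sup>2 * (x\<^sup>2 * gauss x))"
        using integrable_square_gauss by simp
      fix x :: real
      \<comment> \<open>Writing the absolute value as \<open>x * sgn x\<close> turns the integrand
        into the Taylor remainder of sine at \<open>k * x\<close> with increment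
        \<open>d * x\<close>.\<close>
      have "?r x = sgn x * gauss x * (sin (k * x + d * x) - sin (k * x) - (d * x) * cos (k * x))"
        by (simp add: sgn_if algebra_simps)
      also have "norm \<dots> \<le> gauss x * (d * x)\<^sup>2"
        unfolding real_norm_def abs_mult
        by (intro mult_mono sin_add_taylor_bound) (auto simp: sgn_if)
      finally show "norm (?r x) \<le> d\<^sup>2 * (x\<^sup>2 * gauss x)"
        by (simp add: power_mult_distrib mult_ac)
    qed
    then show ?thesis
      unfolding eq C_def integral_mult_right_zero real_norm_def .
  qed
  have "((\<lambda>d. (sine_transform (k + d) - sine_transform k) / d - ?Q) \<longlongrightarrow> 0) (at 0)"
  proof (rule Lim_null_comparison)
    show "\<forall>\<^sub>F d in at 0. norm ((sine_transform (k + d) - sine_transform k) / d - ?Q) \<le> \<bar>d\<bar> * C"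
    proof (rule eventually_at_filter[THEN iffD2], intro always_eventually allI impI)
      fix d :: real assume "d \<noteq> 0"
      then have "(sine_transform (k + d) - sine_transform k) / d - ?Q
          = (sine_transform (k + d) - sine_transform k - d * ?Q) / d"
        using diff_divide_distrib[of "sine_transform (k + d) - sine_transform k" "d * ?Q" d] by simp
      then have "norm ((sine_transform (k + d) - sine_transform k) / d - ?Q)
          = \<bar>sine_transform (k + d) - sine_transform k - d * ?Q\<bar> / \<bar>d\<bar>"
        by (simp add: abs_divide)
      also have "\<dots> \<le> d\<^sup>2 * C / \<bar>d\<bar>"
        by (intro divide_right_mono bound) auto
      also have "\<dots> = \<bar>d\<bar> * C"
        using \<open>d \<noteq> 0\<close> power2_abs[of d] by (metis abs_eq_0 mult.commute nonzero_mult_div_cancel_left power2_eq_square times_divide_eq_right)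
      finally show "norm ((sine_transform (k + d) - sine_transform k) / d - ?Q) \<le> \<bar>d\<bar> * C" .
    qed
    show "((\<lambda>d. \<bar>d\<bar> * C) \<longlongrightarrow> 0) (at 0)"
      by (auto intro!: tendsto_eq_intros)
  qed
  then have "(sine_transform has_real_derivative ?Q) (at k)"
    unfolding DERIV_def by (simp add: LIM_zero_iff)
  then show ?thesis
    by (simp add: integral_abs_gauss_cos)
qed

section \<open>The sine transform as a Gaussian average, and its lower bound\<close>

lemma has_bochner_integral_FTC_interval:
  fixes F f :: "real \<Rightarrow> real"
  assumes "a \<le> b"
    and "\<And>x. a \<le> x \<Longrightarrow> x \<le> b \<Longrightarrow> (F has_real_derivative f x) (at x)"
    and "continuous_on {a..b} f"
  shows "has_bochner_integral lborel (\<lambda>x. indicator {a..b} x * f x) (F b - F a)"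
  using has_bochner_integral_FTC_Icc[of a b F f] assms
  by (auto simp flip: has_real_derivative_iff_has_vector_derivative intro: DERIV_subset)

text \<open>What remains when the equation S' = 2 - k S is solved with an integrating factor and the
  path from 0 to k is rescaled to the unit interval. The positive integrand reveals the sign of the
  transform.\<close>

definition gauss_mean :: "real \<Rightarrow> real" where
  "gauss_mean k = (LINT u|lborel. indicator {0..1} u * exp (- (k\<^sup>2 * (1 - u\<^sup>2) / 2)))"

lemma sine_transform_0 [simp]: "sine_transform 0 = 0"
  by (simp add: sine_transform_def)

text \<open>Variation of constants along \<open>k * u\<close>: in the derivative of \<open>exp (-
  (k\<^sup>2 * (1 - u\<^sup>2) / 2)) * sine_transform (k * u)\<close> the transform cancels, and at
  u = 0 the product vanishes.\<close>

lemma sine_transform_eq: "sine_transform k = 2 * k * gauss_mean k"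
proof -
  have "has_bochner_integral lborel
      (\<lambda>u. indicator {0..1} u * (2 * k * exp (- (k\<^sup>2 * (1 - u\<^sup>2) / 2))))
      (exp (- (k\<^sup>2 * (1 - 1\<^sup>2) / 2)) * sine_transform (k * 1)
       - exp (- (k\<^sup>2 * (1 - 0\<^sup>2) / 2)) * sine_transform (k * 0))"
  proof (rule has_bochner_integral_FTC_interval)
    fix u :: real
    show "((\<lambda>u. exp (- (k\<^sup>2 * (1 - u\<^sup>2) / 2)) * sine_transform (k * u)) has_real_derivative
            2 * k * exp (- (k\<^sup>2 * (1 - u\<^sup>2) / 2))) (at u)"
      by (auto intro!: derivative_eq_intros DERIV_chain2[OF sine_transform_deriv]
          simp: algebra_simps power2_eq_square)
  qed (auto intro!: continuous_intros)
  then have "(LINT u|lborel. indicator {0..1} u * (2 * k * exp (- (k\<^sup>2 * (1 - u\<^sup>2) / 2)))) = sine_transform k"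
    by (simp add: has_bochner_integral_iff)
  then show ?thesis
    by (simp add: gauss_mean_def mult.left_commute[of "indicator _ _"])
qed

text \<open>Jensen's inequality: the tangent of \<open>exp\<close> is taken at the mean \<open>- k\<^sup>2 / 3\<close> of the exponent.\<close>

lemma gauss_mean_ge: "exp (- (k\<^sup>2 / 3)) \<le> gauss_mean k"
proof -
  \<comment> \<open>The exponent exceeds its mean by
    \<open>k\<^sup>2 * u\<^sup>2 / 2 - k\<^sup>2 / 6\<close>, which integrates to 0 over the unit
    interval; hence \<open>?t\<close> integrates to \<open>exp (- (k\<^sup>2 / 3))\<close>.\<close>
  let ?t = "\<lambda>u. exp (- (k\<^sup>2 / 3)) * (1 + k\<^sup>2 * u\<^sup>2 / 2 - k\<^sup>2 / 6)"
  have *: "has_bochner_integral lborel (\<lambda>u. indicator {0..1} u * ?t u)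
      (exp (- (k\<^sup>2 / 3)) * (1 + k\<^sup>2 * 1 ^ 3 / 6 - k\<^sup>2 * 1 / 6)
       - exp (- (k\<^sup>2 / 3)) * (0 + k\<^sup>2 * 0 ^ 3 / 6 - k\<^sup>2 * 0 / 6))"
    by (rule has_bochner_integral_FTC_interval)
       (auto intro!: derivative_eq_intros continuous_intros simp: algebra_simps power2_eq_square)
  have "(LINT u|lborel. indicator {0..1} u * ?t u) \<le> gauss_mean k"
    unfolding gauss_mean_def
  proof (rule integral_mono)
    show "integrable lborel (\<lambda>u. indicator {0..1} u * ?t u)"
      using * by (simp add: has_bochner_integral_iff)
    show "integrable lborel (\<lambda>u. indicator {0..1} u * exp (- (k\<^sup>2 * (1 - u\<^sup>2) / 2)))"
    proof -
      have "continuous_on {0..1} (\<lambda>u. exp (- (k\<^sup>2 * (1 - u\<^sup>2) / 2)))"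
        by (intro continuous_intros) auto
      from borel_integrable_atLeastAtMost'[OF this] show ?thesis
        by (simp add: set_integrable_def)
    qed
    fix u :: real
    have "?t u = exp (- (k\<^sup>2 / 3)) * (1 + (k\<^sup>2 * u\<^sup>2 / 2 - k\<^sup>2 / 6))"
      by simp
    also have "\<dots> \<le> exp (- (k\<^sup>2 / 3)) * exp (k\<^sup>2 * u\<^sup>2 / 2 - k\<^sup>2 / 6)"
      by (intro mult_left_mono exp_ge_add_one_self) auto
    also have "\<dots> = exp (- (k\<^sup>2 * (1 - u\<^sup>2) / 2))"
      by (simp add: field_simps flip: exp_add)
    finally show "indicator {0..1} u * ?t u \<le> indicator {0..1} u * exp (- (k\<^sup>2 * (1 - u\<^sup>2) / 2))"
      by (intro mult_left_mono) auto
  qed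
  then show ?thesis
    using * by (simp add: has_bochner_integral_iff)
qed

lemma gauss_mean_pos: "0 < gauss_mean k"
  using gauss_mean_ge[of k] by (rule less_le_trans[OF exp_gt_zero])

lemma abs_sine_transform_ge: "2 * \<bar>k\<bar> * exp (- (k\<^sup>2 / 3)) \<le> \<bar>sine_transform k\<bar>"
  using gauss_mean_ge[of k] gauss_mean_pos[of k] by (simp add: sine_transform_eq abs_mult mult_left_mono)

lemma sgn_sine_transform: "sgn (sine_transform k) = sgn k"
  using gauss_mean_pos[of k] by (simp add: sine_transform_eq sgn_mult)

lemma continuous_on_sine_transform: "continuous_on S sine_transform"
  using sine_transform_deriv by (intro continuous_at_imp_continuous_on ballI DERIV_isCont) auto

lemma sine_transform_measurable [measurable]: "sine_transform \<in> borel_measurable borel"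
  by (rule borel_measurable_continuous_onI[OF continuous_on_sine_transform])

lemma abs_sine_transform_le: "\<bar>sine_transform k\<bar> \<le> integral\<^sup>L lborel gauss"
  unfolding sine_transform_def real_norm_def[symmetric]
  by (rule Bochner_Integration.integral_norm_bound_integral[OF integrable_sine_transform integrable_gauss])
     (auto simp: abs_mult sgn_if mult_left_le)

section \<open>Integrals of products over product measures\<close>

abbreviation lborel2 :: "(real \<times> real) measure" where
  "lborel2 \<equiv> lborel \<Otimes>\<^sub>M lborel"

lemma (in pair_sigma_finite)
  fixes a :: "'a \<Rightarrow> real" and b :: "'b \<Rightarrow> real"
  assumes int [measurable]: "integrable M1 a" "integrable M2 b"
  shows integrable_tensor: "integrable (M1 \<Otimes>\<^sub>M M2) (\<lambda>(x, y). a x * b y)"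
    and integral_tensor:
      "(LINT (x, y)|(M1 \<Otimes>\<^sub>M M2). a x * b y) = integral\<^sup>L M1 a * integral\<^sup>L M2 b"
proof -
  show *: "integrable (M1 \<Otimes>\<^sub>M M2) (\<lambda>(x, y). a x * b y)"
  proof (rule Fubini_integrable)
    show "(\<lambda>(x, y). a x * b y) \<in> borel_measurable (M1 \<Otimes>\<^sub>M M2)"
      by measurable
    show "integrable M1 (\<lambda>x. LINT y|M2. norm (case (x, y) of (x, y) \<Rightarrow> a x * b y))"
      using int by (simp add: abs_mult)
    show "AE x in M1. integrable M2 (\<lambda>y. case (x, y) of (x, y) \<Rightarrow> a x * b y)"
      using int by simp
  qed
  show "(LINT (x, y)|(M1 \<Otimes>\<^sub>M M2). a x * b y) = integral\<^sup>L M1 a * integral\<^sup>L M2 b"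
    using integral_fst'[OF *] by simp
qed

lemma (in pair_sigma_finite) integrable_tensor_mult_bounded:
  fixes a :: "'a \<Rightarrow> real" and b :: "'b \<Rightarrow> real" and h :: "'a \<Rightarrow> 'b \<Rightarrow> real"
  assumes int: "integrable M1 a" "integrable M2 b"
    and [measurable]: "(\<lambda>(x, y). h x y) \<in> borel_measurable (M1 \<Otimes>\<^sub>M M2)"
    and bound: "\<And>x y. \<bar>h x y\<bar> \<le> C"
  shows "integrable (M1 \<Otimes>\<^sub>M M2) (\<lambda>(x, y). a x * b y * h x y)"
proof (rule Bochner_Integration.integrable_bound)
  note [measurable] = int
  show "integrable (M1 \<Otimes>\<^sub>M M2) (\<lambda>z. C * (case z of (x, y) \<Rightarrow> a x * b y))"
    using integrable_tensor[OF int] by simp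
  show "(\<lambda>(x, y). a x * b y * h x y) \<in> borel_measurable (M1 \<Otimes>\<^sub>M M2)"
    by measurable
  have "\<bar>h x y\<bar> \<le> \<bar>C\<bar>" for x y
    using bound[of x y] by linarith
  then have "norm (a x * b y * h x y) \<le> norm (C * (a x * b y))" for x y
    using mult_left_mono[of "\<bar>h x y\<bar>" "\<bar>C\<bar>" "\<bar>a x * b y\<bar>"] by (simp add: abs_mult mult_ac)
  then show "AE z in M1 \<Otimes>\<^sub>M M2. norm (case z of (x, y) \<Rightarrow> a x * b y * h x y)
      \<le> norm (C * (case z of (x, y) \<Rightarrow> a x * b y))"
    by (intro AE_I2) (simp split: prod.split)
qed

section \<open>The Gaussian integral of the sine transform in closed form\<close>

lemma gauss_mult_exp:
  assumes "0 \<le> u" "u \<le> 1"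
  shows "gauss y * exp (- ((s * y)\<^sup>2 * (1 - u\<^sup>2) / 2)) = gauss (sqrt (1 + s\<^sup>2 * (1 - u\<^sup>2)) * y)"
proof -
  have "0 \<le> s\<^sup>2 * (1 - u\<^sup>2)"
    using assms by (intro mult_nonneg_nonneg) (auto simp: power_le_one)
  then have "(sqrt (1 + s\<^sup>2 * (1 - u\<^sup>2)) * y)\<^sup>2 = y\<^sup>2 + (s * y)\<^sup>2 * (1 - u\<^sup>2)"
    by (simp add: power_mult_distrib algebra_simps)
  then show ?thesis
    by (simp add: gauss_def add_divide_distrib flip: exp_add)
qed

text \<open>With c = \<open>sqrt (1 + s\<^sup>2)\<close> the denominator is
  \<open>c\<^sup>2 - (s * u)\<^sup>2\<close>, so \<open>artanh (s * u / c) / c\<close> is an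
  antiderivative.\<close>

lemma integral_rational_unit:
  assumes "0 \<le> s"
  shows "(LINT u|lborel. indicator {0..1} u * (s / (1 + s\<^sup>2 * (1 - u\<^sup>2)))) = arsinh s / sqrt (1 + s\<^sup>2)"
proof -
  define c where "c = sqrt (1 + s\<^sup>2)"
  have c: "c\<^sup>2 = 1 + s\<^sup>2" "0 < c" "s < c"
    using assms by (auto simp: c_def add_pos_nonneg intro: real_less_rsqrt)
  have "has_bochner_integral lborel (\<lambda>u. indicator {0..1} u * (s / (1 + s\<^sup>2 * (1 - u\<^sup>2))))
     (artanh (s * 1 / c) / c - artanh (s * 0 / c) / c)"
  proof (rule has_bochner_integral_FTC_interval)
    fix u :: real assume u: "0 \<le> u" "u \<le> 1"
    \<comment> \<open>Keeps the argument of \<open>artanh\<close> below 1, including at the endpoint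
      u = 1.\<close>
    have su: "s * u < c" using u assms c mult_left_le[of u s] by linarith
    then have "(s * u)\<^sup>2 < c\<^sup>2" using u assms by (intro power_strict_mono) auto
    then have nz: "c\<^sup>2 - (s * u)\<^sup>2 > 0" by simp
    have "((\<lambda>u. artanh (s * u / c) / c) has_real_derivative 1 / (1 - (s * u / c)\<^sup>2) * (s / c) / c) (at u)"
      using su u assms c
      by (auto intro!: derivative_eq_intros DERIV_chain2[OF artanh_real_has_field_derivative] simp: abs_mult)
    also have "1 / (1 - (s * u / c)\<^sup>2) * (s / c) / c = s / (c\<^sup>2 - (s * u)\<^sup>2)"
    proof -
      have "c\<^sup>2 - (s * u)\<^sup>2 = c\<^sup>2 * (1 - (s * u / c)\<^sup>2)"
        using c(2) by (simp add: right_diff_distrib power_divide)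
      then show ?thesis by (simp add: power2_eq_square)
    qed
    also have "c\<^sup>2 - (s * u)\<^sup>2 = 1 + s\<^sup>2 * (1 - u\<^sup>2)"
      using c by (simp add: algebra_simps power_mult_distrib)
    finally show "((\<lambda>u. artanh (s * u / c) / c) has_real_derivative s / (1 + s\<^sup>2 * (1 - u\<^sup>2))) (at u)" .
  next
    have "1 + s\<^sup>2 * (1 - u\<^sup>2) \<noteq> 0" if "u \<in> {0..1}" for u
    proof -
      have "0 \<le> s\<^sup>2 * (1 - u\<^sup>2)" using that by (intro mult_nonneg_nonneg) (auto simp: power_le_one)
      then show ?thesis by linarith
    qed
    then show "continuous_on {0..1} (\<lambda>u. s / (1 + s\<^sup>2 * (1 - u\<^sup>2)))"
      by (auto intro!: continuous_intros)
  qed simp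
  then have "(LINT u|lborel. indicator {0..1} u * (s / (1 + s\<^sup>2 * (1 - u\<^sup>2)))) = artanh (s / c) / c"
    by (simp add: has_bochner_integral_iff)
  \<comment> \<open>Since \<open>c\<^sup>2 - s\<^sup>2 = 1\<close>, the quotient inside
    \<open>artanh\<close> is the square of \<open>s + c\<close>, and \<open>ln (s + c)\<close> is
    \<open>arsinh s\<close>.\<close>
  also have "artanh (s / c) = arsinh s"
  proof -
    have "(1 + s / c) / (1 - s / c) = (c + s) / (c - s)"
      using c by (simp add: field_simps)
    also have "\<dots> = (s + c)\<^sup>2"
    proof -
      have "(s + c)\<^sup>2 * (c - s) = (s + c) * (c\<^sup>2 - s\<^sup>2)"
        by (simp add: power2_eq_square algebra_simps)
      then show ?thesis using c by (simp add: divide_eq_eq)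
    qed
    finally have "artanh (s / c) = ln ((s + c)\<^sup>2) / 2"
      by (simp add: artanh_def)
    also have "\<dots> = ln (s + c)"
      using c assms by (simp add: ln_realpow)
    finally show ?thesis
      by (simp add: arsinh_real_def c_def add.commute)
  qed
  finally show ?thesis by (simp add: c_def)
qed

text \<open>The averaged form of the transform and Fubini reduce the integral over y to the first
  absolute moment of a scaled Gaussian, which leaves a rational function of u.\<close>

lemma integral_gauss_sine_transform:
  assumes "0 \<le> s"
  shows "(LINT y|lborel. sgn y * gauss y * sine_transform (s * y)) = 4 * arsinh s / sqrt (1 + s\<^sup>2)"
proof -
  let ?f = "\<lambda>u y. indicator {0..1::real} u * (2 * s * (\<bar>y\<bar> * gauss y) * exp (- ((s * y)\<^sup>2 * (1 - u\<^sup>2) / 2)))"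
  have int: "integrable lborel2 (\<lambda>(u, y). ?f u y)"
  proof (rule Bochner_Integration.integrable_bound)
    show "integrable lborel2 (\<lambda>(u, y). indicator {0..1} u * (2 * s * (\<bar>y\<bar> * gauss y)))"
      by (rule lborel_pair.integrable_tensor) (auto intro: integrable_abs_gauss)
    show "(\<lambda>(u, y). ?f u y) \<in> borel_measurable lborel2"
      by measurable
    show "AE z in lborel2. norm (case z of (u, y) \<Rightarrow> ?f u y)
        \<le> norm (case z of (u, y) \<Rightarrow> indicator {0..1} u * (2 * s * (\<bar>y\<bar> * gauss y)))"
      using assms
      by (intro AE_I2) (auto simp: abs_mult indicator_def power_le_one intro!: mult_left_mono mult_left_le)
  qed
  have "(LINT y|lborel. sgn y * gauss y * sine_transform (s * y)) = (LINT y|lborel. LINT u|lborel. ?f u y)"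
  proof (rule Bochner_Integration.integral_cong[OF refl])
    fix y :: real
    have "sgn y * gauss y * sine_transform (s * y) = 2 * s * (\<bar>y\<bar> * gauss y) * gauss_mean (s * y)"
      by (simp add: sine_transform_eq sgn_if)
    also have "\<dots> = (LINT u|lborel. ?f u y)"
      unfolding gauss_mean_def by (subst integral_mult_right_zero[symmetric]) (simp add: mult_ac)
    finally show "sgn y * gauss y * sine_transform (s * y) = (LINT u|lborel. ?f u y)" .
  qed
  also have "\<dots> = (LINT u|lborel. LINT y|lborel. ?f u y)"
    using int by (rule lborel_pair.Fubini_integral)
  also have "\<dots> = (LINT u|lborel. 4 * (indicator {0..1} u * (s / (1 + s\<^sup>2 * (1 - u\<^sup>2)))))"
  proof (rule Bochner_Integration.integral_cong[OF refl])
    fix u :: real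
    show "(LINT y|lborel. ?f u y) = 4 * (indicator {0..1} u * (s / (1 + s\<^sup>2 * (1 - u\<^sup>2))))"
    proof (cases "u \<in> {0..1}")
      case True
      then have "0 \<le> s\<^sup>2 * (1 - u\<^sup>2)" by (intro mult_nonneg_nonneg) (auto simp: power_le_one)
      then have pos: "0 < 1 + s\<^sup>2 * (1 - u\<^sup>2)" by linarith
      have "(LINT y|lborel. ?f u y)
          = (LINT y|lborel. 2 * s * (\<bar>y\<bar> * gauss (sqrt (1 + s\<^sup>2 * (1 - u\<^sup>2)) * y)))"
        using True gauss_mult_exp[of u _ s]
        by (intro Bochner_Integration.integral_cong[OF refl]) (simp add: mult.assoc)
      also have "\<dots> = 2 * s * (2 / (1 + s\<^sup>2 * (1 - u\<^sup>2)))"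
        using pos by (subst integral_mult_right_zero) (simp add: integral_abs_scaled_gauss)
      finally show ?thesis using True by simp
    qed simp
  qed
  also have "\<dots> = 4 * (arsinh s / sqrt (1 + s\<^sup>2))"
    unfolding integral_mult_right_zero integral_rational_unit[OF assms] ..
  finally show ?thesis by simp
qed

section \<open>The Hilbert--Schmidt norm of the kernel\<close>

lemma integrable_gauss2:
  assumes "(\<lambda>(x, y). h x y) \<in> borel_measurable lborel2" and "\<And>x y. \<bar>h x y\<bar> \<le> C"
  shows "integrable lborel2 (\<lambda>(x, y). gauss x * gauss y * h x y)"
  using integrable_gauss integrable_gauss assms by (rule lborel_pair.integrable_tensor_mult_bounded)

text \<open>The parameter s serves two purposes: s = 1 gives the extremal value of the theorem, and
  integration over s gives the bound for the Hilbert--Schmidt norm.\<close>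

lemma integral_gauss2_sgn_sin:
  assumes "0 \<le> s"
  shows "(LINT (x, y)|lborel2. gauss x * gauss y * (sgn x * sgn y * sin (s * (x * y))))
       = 4 * arsinh s / sqrt (1 + s\<^sup>2)"
proof -
  have int: "integrable lborel2 (\<lambda>(x, y). gauss x * gauss y * (sgn x * sgn y * sin (s * (x * y))))"
    by (rule integrable_gauss2[where C = 1]) (auto simp: sgn_if)
  have "(LINT y|lborel. gauss x * gauss y * (sgn x * sgn y * sin (s * (x * y))))
      = sgn x * gauss x * sine_transform (s * x)" for x
    unfolding sine_transform_def
    by (subst integral_mult_right_zero[symmetric]) (simp add: mult_ac)
  then show ?thesis
    using lborel_pair.integral_fst'[OF int] integral_gauss_sine_transform[OF assms] by simp
qed

text \<open>As a function of s, \<open>(sin (s * t))\<^sup>2 / t\<close> has derivative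
  \<open>sin (2 * s * t)\<close>. At t = 0 both sides are 0, the right one by the convention for
  division by 0.\<close>

lemma integral_sgn_sin_interval:
  fixes b t :: real
  assumes "0 \<le> b"
  shows "(LINT s|lborel. indicator {0..b} s * (sgn t * sin (2 * s * t))) = (sin (b * t))\<^sup>2 / \<bar>t\<bar>"
proof (cases "t = 0")
  case False
  have "has_bochner_integral lborel (\<lambda>s. indicator {0..b} s * (sgn t * sin (2 * s * t)))
      (sgn t * (sin (b * t))\<^sup>2 / t - sgn t * (sin (0 * t))\<^sup>2 / t)"
    using assms False
    by (intro has_bochner_integral_FTC_interval)
       (auto intro!: derivative_eq_intros continuous_intros simp: sin_double mult.assoc)
  then show ?thesis
    by (auto simp: has_bochner_integral_iff sgn_if)
qed simp

text \<open>The quotient is written as an integral over s and the order of integration is exchanged.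
  The inner integral is then known, and it is the derivative of
  \<open>(arsinh (2 * s))\<^sup>2\<close>.\<close>

lemma integral_gauss2_sin_square:
  assumes "0 \<le> b"
  shows "(LINT (x, y)|lborel2. gauss x * gauss y * ((sin (b * (x * y)))\<^sup>2 / \<bar>x * y\<bar>)) = (arsinh (2 * b))\<^sup>2"
proof -
  interpret P3: pair_sigma_finite lborel lborel2 ..
  let ?g = "\<lambda>s (x, y). gauss x * gauss y * (sgn x * sgn y * sin (2 * s * (x * y)))"
  have int: "integrable (lborel \<Otimes>\<^sub>M lborel2) (\<lambda>(s, z). indicator {0..b} s * ?g s z)"
  proof -
    have "integrable (lborel \<Otimes>\<^sub>M lborel2) (\<lambda>(s, z). indicator {0..b} s * (case z of (x, y) \<Rightarrow> gauss x * gauss y)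
        * (case z of (x, y) \<Rightarrow> sgn x * sgn y * sin (2 * s * (x * y))))"
      by (rule P3.integrable_tensor_mult_bounded[where C = 1])
         (auto intro: lborel_pair.integrable_tensor integrable_gauss simp: sgn_if emeasure_lborel_Icc_eq)
    then show ?thesis
      by (simp add: case_prod_beta' mult.assoc)
  qed
  have "(LINT (x, y)|lborel2. gauss x * gauss y * ((sin (b * (x * y)))\<^sup>2 / \<bar>x * y\<bar>))
      = (LINT z|lborel2. LINT s|lborel. indicator {0..b} s * ?g s z)"
  proof (rule Bochner_Integration.integral_cong[OF refl])
    fix z :: "real \<times> real"
    obtain x y where z: "z = (x, y)" by (cases z)
    have "gauss x * gauss y * ((sin (b * (x * y)))\<^sup>2 / \<bar>x * y\<bar>)
       = (LINT s|lborel. gauss x * gauss y * (indicator {0..b} s * (sgn (x * y) * sin (2 * s * (x * y)))))"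
      unfolding integral_mult_right_zero integral_sgn_sin_interval[OF assms] ..
    then show "(case z of (x, y) \<Rightarrow> gauss x * gauss y * ((sin (b * (x * y)))\<^sup>2 / \<bar>x * y\<bar>))
       = (LINT s|lborel. indicator {0..b} s * ?g s z)"
      by (simp add: z sgn_mult mult_ac)
  qed
  also have "\<dots> = (LINT s|lborel. LINT z|lborel2. indicator {0..b} s * ?g s z)"
    using int by (rule P3.Fubini_integral)
  also have "\<dots> = (LINT s|lborel. indicator {0..b} s * (4 * arsinh (2 * s) / sqrt (1 + (2 * s)\<^sup>2)))"
  proof (rule Bochner_Integration.integral_cong[OF refl])
    fix s :: real
    show "(LINT z|lborel2. indicator {0..b} s * ?g s z)
        = indicator {0..b} s * (4 * arsinh (2 * s) / sqrt (1 + (2 * s)\<^sup>2))"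
    proof (cases "s \<in> {0..b}")
      case True
      then show ?thesis using integral_gauss2_sgn_sin[of "2 * s"] by simp
    qed simp
  qed
  also have "\<dots> = (arsinh (2 * b))\<^sup>2"
  proof -
    have "has_bochner_integral lborel (\<lambda>s. indicator {0..b} s * (4 * arsinh (2 * s) / sqrt (1 + (2 * s)\<^sup>2)))
        ((arsinh (2 * b))\<^sup>2 - (arsinh (2 * 0))\<^sup>2)"
    proof (rule has_bochner_integral_FTC_interval[OF assms])
      fix s :: real
      show "((\<lambda>s. (arsinh (2 * s))\<^sup>2) has_real_derivative 4 * arsinh (2 * s) / sqrt (1 + (2 * s)\<^sup>2)) (at s)"
        by (auto intro!: derivative_eq_intros DERIV_chain2[OF arsinh_real_has_field_derivative] simp: add.commute)
    next
      have "1 + (2 * s)\<^sup>2 \<noteq> 0" for s :: real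
        using zero_le_power2[of "2 * s"] by linarith
      then show "continuous_on {0..b} (\<lambda>s. 4 * arsinh (2 * s) / sqrt (1 + (2 * s)\<^sup>2))"
        by (auto intro!: continuous_intros)
    qed
    then show ?thesis
      by (simp add: has_bochner_integral_iff)
  qed
  finally show ?thesis .
qed

lemma integral_lborel2_scale:
  fixes f :: "real \<Rightarrow> real \<Rightarrow> real"
  assumes "c > 0" and "integrable lborel2 (\<lambda>(x, y). f x y)"
    and "integrable lborel2 (\<lambda>(x, y). f (c * x) (c * y))"
  shows "(LINT (x, y)|lborel2. f x y) = c\<^sup>2 * (LINT (x, y)|lborel2. f (c * x) (c * y))"
proof -
  have "(LINT (x, y)|lborel2. f x y) = (LINT x|lborel. LINT y|lborel. f x y)"
    using lborel_pair.integral_fst'[OF assms(2)] by simp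
  also have "\<dots> = (LINT x|lborel. c * (LINT y|lborel. f x (c * y)))"
    using assms(1) lborel_integral_real_affine[of c "f _" 0] by simp
  also have "\<dots> = c * (LINT x|lborel. c * (LINT y|lborel. f (c * x) (c * y)))"
    using assms(1) lborel_integral_real_affine[of c "\<lambda>x. c * (LINT y|lborel. f x (c * y))" 0] by simp
  also have "\<dots> = c\<^sup>2 * (LINT x|lborel. LINT y|lborel. f (c * x) (c * y))"
    by (simp add: power2_eq_square)
  also have "(LINT x|lborel. LINT y|lborel. f (c * x) (c * y)) = (LINT (x, y)|lborel2. f (c * x) (c * y))"
    using lborel_pair.integral_fst'[OF assms(3)] by simp
  finally show ?thesis .
qed

lemma sin_square_div_abs_le: "\<bar>(sin t)\<^sup>2 / \<bar>t\<bar>\<bar> \<le> 1" for t :: real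
proof (cases "t = 0")
  case False
  have "(sin t)\<^sup>2 = \<bar>sin t\<bar> * \<bar>sin t\<bar>" by (simp add: power2_eq_square)
  also have "\<dots> \<le> 1 * \<bar>t\<bar>" by (intro mult_mono abs_sin_x_le_abs_x) auto
  finally show ?thesis using False by (simp add: divide_le_eq)
qed simp

lemma arsinh_6_square_less: "(arsinh (6::real))\<^sup>2 < 8"
proof -
  \<comment> \<open>The quadratic Taylor bound at 0.7 is 1 + 0.7 + 0.245 = 1.945, and its fourth
    power exceeds 14.\<close>
  have "(1945 / 1000) ^ 4 \<le> exp (7 / 10 :: real) ^ 4"
    using exp_lower_Taylor_quadratic[of "7 / 10 :: real"]
    by (intro power_mono) (auto simp: power2_eq_square)
  also have "\<dots> = exp (28 / 10)"
    by (simp flip: exp_of_nat_mult)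
  \<comment> \<open>\<open>sqrt 37\<close> is at most 6.1, so the left side is at most 12.1. The
    bound 2.8 for \<open>arsinh 6\<close> suffices because 2.8^2 = 7.84.\<close>
  finally have "6 + sqrt 37 \<le> exp (28 / 10 :: real)"
    using real_le_lsqrt[of "61 / 10" 37] by (simp add: power2_eq_square eval_nat_numeral)
  then have "ln (6 + sqrt 37) \<le> ln (exp (28 / 10 :: real))"
    by (subst ln_le_cancel_iff) (auto simp: add_pos_pos)
  then have "arsinh (6::real) \<le> 28 / 10"
    by (simp add: arsinh_real_def)
  moreover have "0 \<le> arsinh (6::real)"
    by (simp add: arsinh_real_def)
  ultimately have "(arsinh (6::real))\<^sup>2 \<le> (28 / 10)\<^sup>2"
    by (intro power_mono)
  then show ?thesis by (simp add: power2_eq_square)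
qed

section \<open>The weight, the kernel and the bound for its Hilbert--Schmidt norm\<close>

definition weight :: "real \<Rightarrow> real" where
  "weight x = gauss x * \<bar>sine_transform x\<bar>"

definition gauss_sin_kernel :: "real \<Rightarrow> real \<Rightarrow> real" where
  "gauss_sin_kernel x y = gauss x * gauss y * sin (x * y)"

lemma gauss_sin_kernel_measurable [measurable]: "(\<lambda>(x, y). gauss_sin_kernel x y) \<in> borel_measurable lborel2"
  unfolding gauss_sin_kernel_def by measurable

lemma weight_measurable [measurable]: "weight \<in> borel_measurable borel"
  unfolding weight_def by measurable

lemma weight_nonneg [simp]: "0 \<le> weight x"
  by (simp add: weight_def)

lemma weight_pos: "x \<noteq> 0 \<Longrightarrow> 0 < weight x"
  using gauss_mean_pos[of x] by (auto simp: weight_def sine_transform_eq)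

lemma weight_0 [simp]: "weight 0 = 0"
  by (simp add: weight_def)

lemma gauss_sin_kernel_0 [simp]: "gauss_sin_kernel x 0 = 0" "gauss_sin_kernel 0 x = 0"
  by (simp_all add: gauss_sin_kernel_def)

text \<open>The exponent of \<open>(gauss x)\<^sup>2\<close> is split as 1 = 1/6 + 1/2 + 1/3: the
  last two shares and Jensen's bound yield the weight, and 1/6 remains as
  \<open>gauss (x / sqrt 3)\<close>.\<close>

lemma gauss_le_weight: "2 * \<bar>x\<bar> * (gauss x)\<^sup>2 \<le> gauss (x / sqrt 3) * weight x"
proof -
  have "(gauss x)\<^sup>2 = gauss (x / sqrt 3) * (gauss x * exp (- (x\<^sup>2 / 3)))"
    by (simp add: gauss_def power2_eq_square[of "exp _"] power_divide flip: exp_add)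
  then have "2 * \<bar>x\<bar> * (gauss x)\<^sup>2 = gauss (x / sqrt 3) * (gauss x * (2 * \<bar>x\<bar> * exp (- (x\<^sup>2 / 3))))"
    by simp
  also have "\<dots> \<le> gauss (x / sqrt 3) * weight x"
    unfolding weight_def by (intro mult_left_mono abs_sine_transform_ge) auto
  finally show ?thesis .
qed

text \<open>The preceding estimate is applied in each variable, and its two factors 2 give the 1/4.
  On the axes both sides are 0 because division by 0 gives 0.\<close>

lemma kernel_square_le:
  "(gauss_sin_kernel x y)\<^sup>2 / (weight x * weight y)
    \<le> 1 / 4 * (gauss (x / sqrt 3) * gauss (y / sqrt 3) * ((sin (x * y))\<^sup>2 / \<bar>x * y\<bar>))"
proof (cases "x = 0 \<or> y = 0")
  case False
  then have pos: "0 < weight x" "0 < weight y" "0 < \<bar>x\<bar>" "0 < \<bar>y\<bar>"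
    by (auto intro: weight_pos)
  have "(2 * \<bar>x\<bar> * (gauss x)\<^sup>2) * (2 * \<bar>y\<bar> * (gauss y)\<^sup>2)
      \<le> (gauss (x / sqrt 3) * weight x) * (gauss (y / sqrt 3) * weight y)"
    by (intro mult_mono gauss_le_weight) auto
  then have "(gauss x)\<^sup>2 * (gauss y)\<^sup>2 / (weight x * weight y)
      \<le> 1 / 4 * (gauss (x / sqrt 3) * gauss (y / sqrt 3) / \<bar>x * y\<bar>)"
    using pos by (simp add: field_simps abs_mult)
  from mult_right_mono[OF this, of "(sin (x * y))\<^sup>2"] show ?thesis
    by (simp add: gauss_sin_kernel_def power_mult_distrib)
qed auto

lemma integrable_kernel_square: "integrable lborel2 (\<lambda>(x, y). (gauss_sin_kernel x y)\<^sup>2 / (weight x * weight y))"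
  and integral_kernel_square: "(LINT (x, y)|lborel2. (gauss_sin_kernel x y)\<^sup>2 / (weight x * weight y)) < 2"
proof -
  let ?f = "\<lambda>x y. gauss (x / sqrt 3) * gauss (y / sqrt 3) * ((sin (x * y))\<^sup>2 / \<bar>x * y\<bar>)"
  have "integrable lborel (\<lambda>x. gauss (x / sqrt 3))"
    using integrable_scaled_gauss[of "1 / sqrt 3"] by simp
  then have intf: "integrable lborel2 (\<lambda>(x, y). ?f x y)"
    by (intro lborel_pair.integrable_tensor_mult_bounded[where C = 1] sin_square_div_abs_le) auto
  \<comment> \<open>Scaling both variables by \<open>sqrt 3\<close> restores the standard Gaussian
    and makes the frequency 3. The Jacobian 3 cancels the 1/3 from the denominator, so the closed
    form applies with b = 3.\<close>
  have scaled: "?f (sqrt 3 * x) (sqrt 3 * y) = gauss x * gauss y * (1 / 3 * ((sin (3 * (x * y)))\<^sup>2 / \<bar>x * y\<bar>))" for x y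
  proof -
    have "sqrt 3 * x * (sqrt 3 * y) = 3 * (x * y)"
      by (simp add: mult.assoc mult.left_commute[of x] flip: mult.assoc[of "sqrt 3" "sqrt 3"])
    then show ?thesis
      unfolding \<open>sqrt 3 * x * (sqrt 3 * y) = 3 * (x * y)\<close> by (simp add: abs_mult)
  qed
  have bnd: "\<bar>1 / 3 * ((sin (3 * t))\<^sup>2 / \<bar>t\<bar>)\<bar> \<le> 1" for t :: real
    using sin_square_div_abs_le[of "3 * t"] by (simp add: abs_mult)
  have "integrable lborel2 (\<lambda>(x, y). gauss x * gauss y * (1 / 3 * ((sin (3 * (x * y)))\<^sup>2 / \<bar>x * y\<bar>)))"
    by (rule integrable_gauss2[where C = 1, OF _ bnd]) measurable
  then have "integrable lborel2 (\<lambda>(x, y). ?f (sqrt 3 * x) (sqrt 3 * y))"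
    unfolding scaled .
  from integral_lborel2_scale[OF _ intf this]
  have "(LINT (x, y)|lborel2. ?f x y)
      = 3 * (LINT (x, y)|lborel2. 1 / 3 * (gauss x * gauss y * ((sin (3 * (x * y)))\<^sup>2 / \<bar>x * y\<bar>)))"
    unfolding scaled by (simp add: mult_ac)
  also have "\<dots> = (LINT (x, y)|lborel2. gauss x * gauss y * ((sin (3 * (x * y)))\<^sup>2 / \<bar>x * y\<bar>))"
    by (simp only: case_prod_beta' integral_mult_right_zero)
  finally have val: "(LINT (x, y)|lborel2. ?f x y) = (arsinh 6)\<^sup>2"
    by (simp only: integral_gauss2_sin_square) simp
  have int4: "integrable lborel2 (\<lambda>(x, y). 1 / 4 * ?f x y)"
    using integrable_mult_right[OF intf, of "1 / 4"] by (simp add: case_prod_beta')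
  show int: "integrable lborel2 (\<lambda>(x, y). (gauss_sin_kernel x y)\<^sup>2 / (weight x * weight y))"
    by (rule Bochner_Integration.integrable_bound[OF int4])
       (use kernel_square_le in \<open>auto simp: abs_mult intro!: AE_I2\<close>)
  have "(LINT (x, y)|lborel2. (gauss_sin_kernel x y)\<^sup>2 / (weight x * weight y)) \<le> (LINT (x, y)|lborel2. 1 / 4 * ?f x y)"
    by (rule integral_mono[OF int int4]) (use kernel_square_le in auto)
  also have "\<dots> = 1 / 4 * (LINT (x, y)|lborel2. ?f x y)"
    by (simp only: case_prod_beta' integral_mult_right_zero)
  also have "\<dots> < 2"
    using val arsinh_6_square_less by simp
  finally show "(LINT (x, y)|lborel2. (gauss_sin_kernel x y)\<^sup>2 / (weight x * weight y)) < 2" .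
qed

section \<open>Bilinear forms orthogonal to the sign function\<close>

text \<open>The value \<open>sgn 0 = 0\<close> does no harm because the weight vanishes at 0
  too.\<close>

lemma sgn_square_weight: "sgn x * sgn x * weight x = weight x"
  by (cases "x = 0") (auto simp: sgn_if)

text \<open>The eigenvalue equation for \<open>sgn\<close>. The integral is \<open>gauss x\<close>
  times the sine transform, and the transform has the sign of its argument, so the absolute value in
  \<open>weight\<close> can be undone.\<close>

lemma integral_sgn_gauss_sin_kernel: "(LINT y|lborel. sgn y * gauss_sin_kernel x y) = sgn x * weight x"
proof -
  have "(LINT y|lborel. sgn y * gauss_sin_kernel x y) = gauss x * sine_transform x"
    unfolding sine_transform_def gauss_sin_kernel_def
    by (subst integral_mult_right_zero[symmetric]) (simp add: mult_ac)
  also have "\<dots> = sgn (sine_transform x) * weight x"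
    by (simp add: weight_def mult_sgn_abs mult.left_commute[of "gauss x"])
  finally show ?thesis
    by (simp add: sgn_sine_transform)
qed

lemma integrable_kernel_mult:
  assumes [measurable]: "(\<lambda>(x, y). h x y) \<in> borel_measurable lborel2" and bound: "\<And>x y. \<bar>h x y\<bar> \<le> C"
  shows "integrable lborel2 (\<lambda>(x, y). h x y * gauss_sin_kernel x y)"
proof -
  have "integrable lborel2 (\<lambda>(x, y). gauss x * gauss y * (h x y * sin (x * y)))"
  proof (rule integrable_gauss2)
    show "\<bar>h x y * sin (x * y)\<bar> \<le> C" for x y
      using mult_left_le[of "\<bar>sin (x * y)\<bar>" "\<bar>h x y\<bar>"] bound[of x y] by (simp add: abs_mult)
  qed measurable
  then show ?thesis
    by (simp add: gauss_sin_kernel_def mult_ac)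
qed

lemma integrable_weight_mult:
  assumes [measurable]: "h \<in> borel_measurable borel" and bound: "\<And>x. \<bar>h x\<bar> \<le> C"
  shows "integrable lborel (\<lambda>x. h x * weight x)"
proof (rule Bochner_Integration.integrable_bound)
  show "integrable lborel (\<lambda>x. C * (gauss x * integral\<^sup>L lborel gauss))"
    using integrable_gauss by simp
  have "0 \<le> C" using bound[of 0] by linarith
  then show "AE x in lborel. norm (h x * weight x) \<le> norm (C * (gauss x * integral\<^sup>L lborel gauss))"
    unfolding weight_def real_norm_def abs_mult
    by (intro AE_I2 mult_mono) (auto intro!: order_trans[OF bound] order_trans[OF abs_sine_transform_le])
qed measurable

lemma integrable_weight: "integrable lborel weight"
  using integrable_weight_mult[of "\<lambda>_. 1" 1] by simp

section \<open>The bilinear form and its value at the sign function\<close>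

definition total_weight :: real where
  "total_weight = integral\<^sup>L lborel weight"

definition kernel_form :: "(real \<Rightarrow> real) \<Rightarrow> (real \<Rightarrow> real) \<Rightarrow> real" where
  "kernel_form f g = (LINT (x, y)|lborel2. f x * g y * gauss_sin_kernel x y)"

lemma integrable_kernel_form:
  assumes [measurable]: "f \<in> borel_measurable borel" "g \<in> borel_measurable borel"
    and "\<And>x. \<bar>f x\<bar> \<le> C" "\<And>x. \<bar>g x\<bar> \<le> D"
  shows "integrable lborel2 (\<lambda>(x, y). f x * g y * gauss_sin_kernel x y)"
proof (rule integrable_kernel_mult)
  have "0 \<le> C" using assms(3)[of 0] by linarith
  then show "\<bar>f x * g y\<bar> \<le> C * D" for x y
    unfolding abs_mult by (intro mult_mono assms) auto
qed measurable

lemma kernel_form_commute: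
  assumes [measurable]: "f \<in> borel_measurable borel" "g \<in> borel_measurable borel"
  shows "kernel_form f g = kernel_form g f"
proof -
  have "kernel_form f g = (LINT (x, y)|lborel2. f y * g x * gauss_sin_kernel y x)"
    unfolding kernel_form_def
    by (subst lborel_pair.integral_product_swap[symmetric]) (auto simp: case_prod_beta')
  then show ?thesis
    by (simp add: kernel_form_def gauss_sin_kernel_def mult_ac)
qed

text \<open>By the eigenvalue equation, pairing with \<open>sgn\<close> through the kernel is the
  same as the weighted inner product with \<open>sgn\<close>.\<close>

lemma kernel_form_sgn_right:
  assumes [measurable]: "f \<in> borel_measurable borel" and "\<And>x. \<bar>f x\<bar> \<le> C"
  shows "kernel_form f sgn = (LINT x|lborel. f x * sgn x * weight x)"
proof -
  have int: "integrable lborel2 (\<lambda>(x, y). f x * sgn y * gauss_sin_kernel x y)"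
    by (rule integrable_kernel_form[where D = 1, OF _ _ assms(2)]) (auto simp: sgn_if)
  have "(LINT y|lborel. f x * sgn y * gauss_sin_kernel x y) = f x * sgn x * weight x" for x
    unfolding mult.assoc integral_mult_right_zero integral_sgn_gauss_sin_kernel ..
  then show ?thesis
    using lborel_pair.integral_fst'[OF int] by (simp add: kernel_form_def)
qed

lemma abs_sgn_le_1: "\<bar>sgn x\<bar> \<le> 1" for x :: real
  by (simp add: sgn_if)

lemma kernel_form_sgn_sgn: "kernel_form sgn sgn = total_weight"
  using kernel_form_sgn_right[OF sgn_measurable abs_sgn_le_1] by (simp only: total_weight_def sgn_square_weight)

text \<open>The squared weighted norm of \<open>sgn\<close> equals the form at \<open>sgn\<close>,
  because the eigenvalue is 1; the closed form at s = 1 evaluates it.\<close>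

lemma total_weight_eq: "total_weight = 2 * sqrt 2 * ln (1 + sqrt 2)"
proof -
  have "kernel_form sgn sgn = 4 * arsinh 1 / sqrt 2"
    using integral_gauss2_sgn_sin[of 1] by (simp add: kernel_form_def gauss_sin_kernel_def mult_ac)
  also have "\<dots> = 2 * sqrt 2 * ln (1 + sqrt 2)"
    by (simp add: arsinh_real_def field_simps)
  finally show ?thesis
    by (simp add: kernel_form_sgn_sgn)
qed

lemma total_weight_pos: "0 < total_weight"
  unfolding total_weight_eq by (intro mult_pos_pos ln_gt_zero) auto

text \<open>The discriminant criterion, with the degenerate case V = 0 included. It extracts
  Cauchy--Schwarz from a family of nonnegative integrals.\<close>

lemma square_le_of_quadratic_nonneg:
  fixes S V k :: real
  assumes "\<And>c. 0 \<le> k - 2 * c * S + c\<^sup>2 * V" and "0 \<le> V"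
  shows "S\<^sup>2 \<le> k * V"
proof (cases "V = 0")
  case True
  have "S = 0"
  proof (rule ccontr)
    assume "S \<noteq> 0"
    \<comment> \<open>This c makes the expression, linear for V = 0, equal to -1.\<close>
    then show False using assms(1)[of "(k + 1) / (2 * S)"] True by simp
  qed
  then show ?thesis using True by simp
next
  case False
  \<comment> \<open>S / V is the minimizer of the quadratic in c.\<close>
  then have "0 \<le> V * (k - 2 * (S / V) * S + (S / V)\<^sup>2 * V)"
    by (intro mult_nonneg_nonneg assms)
  also have "\<dots> = k * V - S\<^sup>2"
    using False by (simp add: field_simps power2_eq_square)
  finally show ?thesis by simp
qed

definition kernel_norm_square :: real where
  "kernel_norm_square = (LINT (x, y)|lborel2. (gauss_sin_kernel x y)\<^sup>2 / (weight x * weight y))"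

text \<open>
  Removing the rank one part that belongs to the eigenvalue \<open>1\<close> lowers the squared
  Hilbert--Schmidt norm by \<open>1\<close>. The Cauchy--Schwarz inequality for the remaining kernel is obtained
  by expanding a square that is nonnegative for every \<open>c\<close>.
\<close>

lemma kernel_form_orthogonal_bound:
  assumes [measurable]: "\<phi> \<in> borel_measurable borel" "\<psi> \<in> borel_measurable borel"
    and b: "\<And>x. \<bar>\<phi> x\<bar> \<le> C" "\<And>x. \<bar>\<psi> x\<bar> \<le> D"
    and orth: "(LINT x|lborel. \<phi> x * sgn x * weight x) = 0"
  shows "(kernel_form \<phi> \<psi>)\<^sup>2 \<le> (kernel_norm_square - 1) *
    ((LINT x|lborel. (\<phi> x)\<^sup>2 * weight x) * (LINT x|lborel. (\<psi> x)\<^sup>2 * weight x))"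
proof (rule square_le_of_quadratic_nonneg)
  let ?V = "\<lambda>\<phi>. LINT x|lborel. (\<phi> x)\<^sup>2 * weight x"
  let ?W = total_weight
  have "0 \<le> C" "0 \<le> D" using b(1)[of 0] b(2)[of 0] by linarith+
  have pw: "integrable lborel (\<lambda>x. (\<phi> x)\<^sup>2 * weight x)"
    using b(1) by (intro integrable_weight_mult[where C = "C\<^sup>2"]) (auto simp: abs_le_square_iff[symmetric] \<open>0 \<le> C\<close>)
  have qw: "integrable lborel (\<lambda>x. (\<psi> x)\<^sup>2 * weight x)"
    using b(2) by (intro integrable_weight_mult[where C = "D\<^sup>2"]) (auto simp: abs_le_square_iff[symmetric] \<open>0 \<le> D\<close>)
  have ps: "integrable lborel (\<lambda>x. \<phi> x * sgn x * weight x)"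
    using b(1) by (intro integrable_weight_mult[where C = C]) (auto simp: sgn_if intro: order_trans[OF abs_ge_zero])
  have qs: "integrable lborel (\<lambda>x. \<psi> x * sgn x * weight x)"
    using b(2) by (intro integrable_weight_mult[where C = D]) (auto simp: sgn_if intro: order_trans[OF abs_ge_zero])
  show "0 \<le> ?V \<phi> * ?V \<psi>"
    by (intro mult_nonneg_nonneg integral_nonneg_AE) auto
  fix c :: real
  \<comment> \<open>Relative to \<open>?ww\<close>, the first summand is the density of the spectral
    projection onto \<open>sgn\<close>, normalized by its squared norm \<open>?W\<close>; the second
    is the test direction of Cauchy--Schwarz.\<close>
  let ?E = "\<lambda>x y. sgn x * sgn y / ?W + c * (\<phi> x * \<psi> y)"
  let ?ww = "\<lambda>x y. weight x * weight y"
  let ?R = "\<lambda>x y. (gauss_sin_kernel x y - ?E x y * ?ww x y)\<^sup>2 / ?ww x y"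
  define t1 where "t1 = (\<lambda>(x, y). (gauss_sin_kernel x y)\<^sup>2 / ?ww x y)"
  define t2 where "t2 = (\<lambda>(x, y). sgn x * sgn y * gauss_sin_kernel x y)"
  define t3 where "t3 = (\<lambda>(x, y). \<phi> x * \<psi> y * gauss_sin_kernel x y)"
  define t4 where "t4 = (\<lambda>(x, y). weight x * weight y)"
  define t5 where "t5 = (\<lambda>(x, y). (\<phi> x * sgn x * weight x) * (\<psi> y * sgn y * weight y))"
  define t6 where "t6 = (\<lambda>(x, y). ((\<phi> x)\<^sup>2 * weight x) * ((\<psi> y)\<^sup>2 * weight y))"
  have i1: "integrable lborel2 t1"
    unfolding t1_def by (rule integrable_kernel_square)
  have i2: "integrable lborel2 t2"
    unfolding t2_def by (rule integrable_kernel_form[OF _ _ abs_sgn_le_1 abs_sgn_le_1]) measurable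
  have i3: "integrable lborel2 t3"
    unfolding t3_def by (rule integrable_kernel_form[OF _ _ b]) measurable
  have i4: "integrable lborel2 t4"
    unfolding t4_def by (rule lborel_pair.integrable_tensor[OF integrable_weight integrable_weight])
  have i5: "integrable lborel2 t5"
    unfolding t5_def by (rule lborel_pair.integrable_tensor[OF ps qs])
  have i6: "integrable lborel2 t6"
    unfolding t6_def by (rule lborel_pair.integrable_tensor[OF pw qw])
  have v1: "integral\<^sup>L lborel2 t1 = kernel_norm_square"
    by (simp add: t1_def kernel_norm_square_def)
  have v2: "integral\<^sup>L lborel2 t2 = ?W"
    by (simp add: t2_def kernel_form_def flip: kernel_form_sgn_sgn)
  have v3: "integral\<^sup>L lborel2 t3 = kernel_form \<phi> \<psi>"
    by (simp add: t3_def kernel_form_def)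
  have v4: "integral\<^sup>L lborel2 t4 = ?W * ?W"
    unfolding t4_def lborel_pair.integral_tensor[OF integrable_weight integrable_weight] total_weight_def ..
  \<comment> \<open>The cross term between projection and test direction factors into two integrals,
    so orthogonality of \<open>\<phi>\<close> alone makes it vanish.\<close>
  have v5: "integral\<^sup>L lborel2 t5 = 0"
    unfolding t5_def lborel_pair.integral_tensor[OF ps qs] orth by simp
  have v6: "integral\<^sup>L lborel2 t6 = ?V \<phi> * ?V \<psi>"
    unfolding t6_def lborel_pair.integral_tensor[OF pw qw] ..
  have eq: "?R x y = t1 (x, y) - 2 / ?W * t2 (x, y) - 2 * c * t3 (x, y)
      + 1 / ?W\<^sup>2 * t4 (x, y) + 2 * c / ?W * t5 (x, y) + c\<^sup>2 * t6 (x, y)" for x y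
  proof (cases "x = 0 \<or> y = 0")
    case False
    then have ww: "?ww x y \<noteq> 0" using weight_pos[of x] weight_pos[of y] by auto
    have ss: "(sgn x)\<^sup>2 = 1" "(sgn y)\<^sup>2 = 1"
      using False by (auto simp: sgn_if)
    have "?R x y = t1 (x, y) - 2 * ?E x y * gauss_sin_kernel x y + (?E x y)\<^sup>2 * ?ww x y"
      using ww by (simp add: t1_def power2_diff power_mult_distrib diff_divide_distrib add_divide_distrib)
        (simp add: power2_eq_square)
    also have "(?E x y)\<^sup>2 = 1 / ?W\<^sup>2 + 2 * c / ?W * (\<phi> x * sgn x * (\<psi> y * sgn y)) + c\<^sup>2 * ((\<phi> x)\<^sup>2 * (\<psi> y)\<^sup>2)"
      by (simp add: power2_sum power_mult_distrib power_divide ss mult_ac)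
    finally show ?thesis
      by (simp add: t2_def t3_def t4_def t5_def t6_def algebra_simps)
  qed (auto simp: t1_def t2_def t3_def t4_def t5_def t6_def)
  have "0 \<le> (LINT z|lborel2. (case z of (x, y) \<Rightarrow> ?R x y))"
    by (intro integral_nonneg_AE AE_I2) (auto simp: case_prod_beta')
  also have "\<dots> = (LINT z|lborel2. t1 z - 2 / ?W * t2 z - 2 * c * t3 z
      + 1 / ?W\<^sup>2 * t4 z + 2 * c / ?W * t5 z + c\<^sup>2 * t6 z)"
  proof (rule Bochner_Integration.integral_cong[OF refl])
    fix z :: "real \<times> real"
    obtain x y where z: "z = (x, y)" by (cases z)
    show "(case z of (x, y) \<Rightarrow> ?R x y) = t1 z - 2 / ?W * t2 z - 2 * c * t3 z
      + 1 / ?W\<^sup>2 * t4 z + 2 * c / ?W * t5 z + c\<^sup>2 * t6 z"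
      by (simp only: z prod.case eq)
  qed
  also have "\<dots> = kernel_norm_square - 2 / ?W * ?W - 2 * c * kernel_form \<phi> \<psi>
      + 1 / ?W\<^sup>2 * (?W * ?W) + 2 * c / ?W * 0 + c\<^sup>2 * (?V \<phi> * ?V \<psi>)"
    by (simp add: i1 i2 i3 i4 i5 i6 v1 v2 v3 v4 v5 v6)
  \<comment> \<open>The projection contributes -2 through its pairing with the kernel and +1 through
    its own square, hence the -1.\<close>
  also have "\<dots> = kernel_norm_square - 1 - 2 * c * kernel_form \<phi> \<psi> + c\<^sup>2 * (?V \<phi> * ?V \<psi>)"
    using total_weight_pos by (simp add: power2_eq_square)
  finally show "0 \<le> kernel_norm_square - 1 - 2 * c * kernel_form \<phi> \<psi> + c\<^sup>2 * (?V \<phi> * ?V \<psi>)" .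
qed

section \<open>Decomposition along the sign function and the sharp bound\<close>

definition sgn_coeff :: "(real \<Rightarrow> real) \<Rightarrow> real" where
  "sgn_coeff f = (LINT x|lborel. f x * sgn x * weight x) / total_weight"

text \<open>Pythagoras in the weighted space: \<open>sgn_coeff f\<close> is the coefficient of the
  orthogonal projection of \<open>f\<close> onto \<open>sgn\<close>, and \<open>f\<close> has the
  same norm as \<open>sgn\<close>. The coefficient is bounded by 1 because the remainder has
  nonnegative squared norm.\<close>

lemma
  assumes [measurable]: "f \<in> borel_measurable borel" and f: "\<And>x. f x \<in> {-1, 1}"
  shows sgn_coeff_remainder_orthogonal:
      "(LINT x|lborel. (f x - sgn_coeff f * sgn x) * sgn x * weight x) = 0" (is ?orth)
    and sgn_coeff_remainder_norm:
      "(LINT x|lborel. (f x - sgn_coeff f * sgn x)\<^sup>2 * weight x) = total_weight * (1 - (sgn_coeff f)\<^sup>2)" (is ?norm)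
    and abs_sgn_coeff_le: "\<bar>sgn_coeff f\<bar> \<le> 1" (is ?le)
proof -
  define p where "p = sgn_coeff f"
  have f2: "(f x)\<^sup>2 = 1" "\<bar>f x\<bar> = 1" for x
    using f[of x] by auto
  have int: "integrable lborel (\<lambda>x. f x * sgn x * weight x)"
    by (rule integrable_weight_mult[where C = 1]) (auto simp: sgn_if f2)
  have val: "(LINT x|lborel. f x * sgn x * weight x) = p * total_weight"
    using total_weight_pos by (simp add: p_def sgn_coeff_def)
  have "(LINT x|lborel. (f x - p * sgn x) * sgn x * weight x)
      = (LINT x|lborel. f x * sgn x * weight x - p * weight x)"
    by (rule Bochner_Integration.integral_cong) (auto simp: left_diff_distrib mult.assoc)
  also have "\<dots> = p * total_weight - p * total_weight"
    by (simp add: int integrable_weight val total_weight_def)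
  finally show ?orth by (simp add: p_def)
  have "(LINT x|lborel. (f x - p * sgn x)\<^sup>2 * weight x)
      = (LINT x|lborel. weight x - 2 * p * (f x * sgn x * weight x) + p\<^sup>2 * weight x)"
  proof (rule Bochner_Integration.integral_cong[OF refl])
    fix x :: real
    have "(f x - p * sgn x)\<^sup>2 * weight x
        = (f x)\<^sup>2 * weight x - 2 * p * (f x * sgn x * weight x) + p\<^sup>2 * (sgn x * sgn x * weight x)"
      by (simp only: power2_eq_square) (simp only: algebra_simps)
    then show "(f x - p * sgn x)\<^sup>2 * weight x = weight x - 2 * p * (f x * sgn x * weight x) + p\<^sup>2 * weight x"
      by (simp only: f2 sgn_square_weight mult_1)
  qed
  also have "\<dots> = total_weight - 2 * p * (p * total_weight) + p\<^sup>2 * total_weight"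
    by (simp add: int integrable_weight val total_weight_def)
  also have "\<dots> = total_weight * (1 - p\<^sup>2)"
    by (simp add: algebra_simps power2_eq_square)
  finally show n: ?norm by (simp add: p_def)
  have "0 \<le> (LINT x|lborel. (f x - sgn_coeff f * sgn x)\<^sup>2 * weight x)"
    by (intro integral_nonneg_AE) auto
  then have "p\<^sup>2 \<le> 1\<^sup>2"
    using total_weight_pos unfolding n by (simp add: zero_le_mult_iff p_def)
  then show ?le
    using abs_le_square_iff[of p 1] by (simp add: p_def)
qed

text \<open>Since \<open>sgn\<close> is an eigenfunction and the kernel is symmetric, the form
  splits along the decomposition without mixed terms.\<close>

lemma kernel_form_eq_remainder:
  assumes [measurable]: "f \<in> borel_measurable borel" "g \<in> borel_measurable borel"
    and f: "\<And>x. f x \<in> {-1, 1}" and g: "\<And>x. g x \<in> {-1, 1}"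
  defines "p \<equiv> sgn_coeff f" and "q \<equiv> sgn_coeff g"
  shows "kernel_form f g
    = p * q * total_weight + kernel_form (\<lambda>x. f x - p * sgn x) (\<lambda>x. g x - q * sgn x)"
proof -
  have b: "\<bar>f x\<bar> \<le> 1" "\<bar>g x\<bar> \<le> 1" "\<bar>sgn x\<bar> \<le> 1" for x
    using f[of x] g[of x] by (auto simp: sgn_if)
  have m [measurable]: "f \<in> borel_measurable borel" "g \<in> borel_measurable borel" "sgn \<in> borel_measurable (borel :: real measure)"
    by measurable
  have i: "integrable lborel2 (\<lambda>(x, y). f x * g y * gauss_sin_kernel x y)"
    "integrable lborel2 (\<lambda>(x, y). f x * sgn y * gauss_sin_kernel x y)"
    "integrable lborel2 (\<lambda>(x, y). sgn x * g y * gauss_sin_kernel x y)"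
    "integrable lborel2 (\<lambda>(x, y). sgn x * sgn y * gauss_sin_kernel x y)"
    by (rule integrable_kernel_form[where C = 1 and D = 1]; use m b in simp)+
  have "kernel_form (\<lambda>x. f x - p * sgn x) (\<lambda>x. g x - q * sgn x)
     = (LINT z|lborel2. (case z of (x, y) \<Rightarrow> f x * g y * gauss_sin_kernel x y)
        - q * (case z of (x, y) \<Rightarrow> f x * sgn y * gauss_sin_kernel x y)
        - p * (case z of (x, y) \<Rightarrow> sgn x * g y * gauss_sin_kernel x y)
        + p * q * (case z of (x, y) \<Rightarrow> sgn x * sgn y * gauss_sin_kernel x y))"
    unfolding kernel_form_def
    by (rule Bochner_Integration.integral_cong) (auto simp: algebra_simps)
  also have "\<dots> = kernel_form f g - q * kernel_form f sgn - p * kernel_form sgn g + p * q * kernel_form sgn sgn"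
    by (simp add: i kernel_form_def)
  also have "kernel_form f sgn = p * total_weight"
    using total_weight_pos kernel_form_sgn_right[OF m(1) b(1)] by (simp add: p_def sgn_coeff_def)
  also have "kernel_form sgn g = q * total_weight"
    using total_weight_pos kernel_form_sgn_right[OF m(2) b(2)]
    by (simp add: q_def sgn_coeff_def kernel_form_commute[of sgn g])
  finally show ?thesis
    by (simp add: kernel_form_sgn_sgn algebra_simps)
qed

text \<open>The remainder term S has to be at most N, the deficit left by the component along
  \<open>sgn\<close>. This follows from \<open>S\<^sup>2 \<le> (kernel_norm_square - 1) * M\<close>
  and \<open>M \<le> N\<^sup>2\<close>; the factor being strictly less than 1 settles
  equality.\<close>

lemma kernel_form_bound:
  assumes m: "f \<in> borel_measurable borel" "g \<in> borel_measurable borel"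
    and f: "\<And>x. f x \<in> {-1, 1}" and g: "\<And>x. g x \<in> {-1, 1}"
  shows "kernel_form f g \<le> total_weight" (is ?le)
    and "kernel_form f g = total_weight \<Longrightarrow>
      sgn_coeff f = sgn_coeff g \<and> sgn_coeff f \<in> {-1, 1}" (is "?eq \<Longrightarrow> ?coeff")
proof -
  note [measurable] = m
  define p q where "p = sgn_coeff f" and "q = sgn_coeff g"
  define S where "S = kernel_form (\<lambda>x. f x - p * sgn x) (\<lambda>x. g x - q * sgn x)"
  define M where "M = total_weight\<^sup>2 * ((1 - p\<^sup>2) * (1 - q\<^sup>2))"
  define N where "N = total_weight * (1 - p * q)"
  have pq1: "\<bar>p\<bar> \<le> 1" "\<bar>q\<bar> \<le> 1"
    unfolding p_def q_def using abs_sgn_coeff_le m f g by auto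
  then have "\<bar>p * q\<bar> \<le> 1"
    by (simp add: abs_mult mult_le_one)
  then have pq: "p * q \<le> 1" by linarith
  then have N: "0 \<le> N"
    using total_weight_pos by (simp add: N_def)
  have form: "kernel_form f g = p * q * total_weight + S"
    unfolding S_def p_def q_def by (rule kernel_form_eq_remainder[OF m f g])
  have b: "\<bar>h x - r * sgn x\<bar> \<le> 2" if "h x \<in> {-1, 1}" "\<bar>r\<bar> \<le> 1" for h :: "real \<Rightarrow> real" and r x
    using that by (auto simp: sgn_if)
  have "S\<^sup>2 \<le> (kernel_norm_square - 1) * ((total_weight * (1 - p\<^sup>2)) * (total_weight * (1 - q\<^sup>2)))"
    unfolding S_def p_def q_def
      sgn_coeff_remainder_norm[OF m(1) f, symmetric] sgn_coeff_remainder_norm[OF m(2) g, symmetric]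
    by (rule kernel_form_orthogonal_bound[OF _ _ b b])
       (use f g pq1 sgn_coeff_remainder_orthogonal[OF m(1) f] in \<open>auto simp: p_def q_def\<close>)
  also have "\<dots> = (kernel_norm_square - 1) * M"
    by (simp add: M_def power2_eq_square mult_ac)
  finally have S: "S\<^sup>2 \<le> (kernel_norm_square - 1) * M" .
  \<comment> \<open>Dropping the square of p - q compares the product of the two remainder norms
    with the square of the deficit.\<close>
  have "(1 - p\<^sup>2) * (1 - q\<^sup>2) = (1 - p * q)\<^sup>2 - (p - q)\<^sup>2"
    by (simp add: power2_eq_square algebra_simps)
  then have le: "M \<le> N\<^sup>2"
    by (simp add: N_def M_def power_mult_distrib mult_left_mono)
  have nonneg: "0 \<le> M"
    unfolding M_def using pq1 by (intro mult_nonneg_nonneg) (auto simp: abs_square_le_1)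
  have lt: "kernel_norm_square - 1 < 1"
    using integral_kernel_square by (simp add: kernel_norm_square_def)
  have "S\<^sup>2 \<le> 1 * M"
    using lt by (intro order_trans[OF S] mult_right_mono nonneg) simp
  then have SN: "S\<^sup>2 \<le> N\<^sup>2" using le by simp
  then have "S \<le> N"
    using N by (rule power2_le_imp_le)
  then show ?le
    by (simp add: form N_def algebra_simps)
  assume ?eq
  then have "S = N"
    by (simp add: form N_def algebra_simps)
  \<comment> \<open>If N were nonzero, M would be positive, and the strict factor would give
    \<open>N\<^sup>2 < M\<close>, against \<open>M \<le> N\<^sup>2\<close>.\<close>
  have "N = 0"
  proof (rule ccontr)
    assume "N \<noteq> 0"
    then have "0 < N\<^sup>2" by simp
    then have "M \<noteq> 0"
      using S \<open>S = N\<close> by auto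
    then have pos: "0 < M"
      using nonneg by simp
    have "N\<^sup>2 < 1 * M"
      using S \<open>S = N\<close> mult_strict_right_mono[OF lt pos] by simp
    then show False using le by simp
  qed
  then have pq_eq: "p * q = 1"
    using total_weight_pos by (simp add: N_def)
  then have "\<bar>p\<bar> * \<bar>q\<bar> = 1"
    by (simp flip: abs_mult)
  then have "\<bar>p\<bar> = 1"
    using pq1 mult_left_le[of "\<bar>q\<bar>" "\<bar>p\<bar>"] by linarith
  then have "p \<in> {-1, 1}" by auto
  moreover from this pq_eq have "p = q" by auto
  ultimately show ?coeff by (simp add: p_def q_def)
qed

text \<open>For a coefficient of modulus 1 the remainder has weighted norm 0, and the weight is
  positive off the null set \<open>{0}\<close>.\<close>

lemma AE_eq_sgn_of_sgn_coeff:
  assumes m: "f \<in> borel_measurable borel" and f: "\<And>x. f x \<in> {-1, 1}"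
    and "sgn_coeff f \<in> {-1, 1}"
  shows "AE x in lborel. f x = sgn_coeff f * sgn x"
proof -
  note [measurable] = m
  let ?r = "\<lambda>x. f x - sgn_coeff f * sgn x"
  have "\<bar>?r x\<bar> \<le> 2" for x
    using f[of x] assms(3) by (auto simp: sgn_if)
  then have "(?r x)\<^sup>2 \<le> 2\<^sup>2" for x
    by (metis abs_le_square_iff abs_numeral)
  then have int: "integrable lborel (\<lambda>x. (?r x)\<^sup>2 * weight x)"
    by (intro integrable_weight_mult[where C = "2\<^sup>2"]) auto
  have "(LINT x|lborel. (?r x)\<^sup>2 * weight x) = 0"
    using sgn_coeff_remainder_norm[OF m f] assms(3) by auto
  then have "AE x in lborel. (?r x)\<^sup>2 * weight x = 0"
    using integral_nonneg_eq_0_iff_AE[OF int] by simp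
  with AE_lborel_singleton[of "0::real"] show ?thesis
    by eventually_elim (auto dest: weight_pos)
qed

section \<open>From Lebesgue measurable functions to Borel representatives\<close>

lemma gauss_sin_form_eq_kernel_form:
  assumes f: "f \<in> borel_measurable lebesgue" and g: "g \<in> borel_measurable lebesgue"
    and m: "f' \<in> borel_measurable borel" "g' \<in> borel_measurable borel"
    and b: "\<And>x. \<bar>f' x\<bar> \<le> 1" "\<And>x. \<bar>g' x\<bar> \<le> 1"
    and ae: "AE x in lborel. f x = f' x" "AE x in lborel. g x = g' x"
  shows "gauss_sin_form f g = kernel_form f' g'"
proof -
  note [measurable] = m
  define h where "h y = (LINT x|lborel. f' x * gauss_sin_kernel x y)" for y
  have [measurable]: "h \<in> borel_measurable borel"
    unfolding h_def by measurable
  \<comment> \<open>For each fixed y the integrands differ only on a null set of x, so the inner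
    integrals agree for every y. Then only \<open>g\<close> has to be replaced almost everywhere in
    the outer integral.\<close>
  have inner: "(LINT x|lebesgue. f x * gauss_sin_kernel x y) = h y" for y
  proof -
    have k [measurable]: "(\<lambda>x. gauss_sin_kernel x y) \<in> borel_measurable borel"
      unfolding gauss_sin_kernel_def by measurable
    have "(LINT x|lebesgue. f x * gauss_sin_kernel x y) = (LINT x|lebesgue. f' x * gauss_sin_kernel x y)"
    proof (rule integral_cong_AE)
      show "(\<lambda>x. f x * gauss_sin_kernel x y) \<in> borel_measurable lebesgue"
        by (intro borel_measurable_times f measurable_completion) (simp add: k)
      show "(\<lambda>x. f' x * gauss_sin_kernel x y) \<in> borel_measurable lebesgue"
        by (intro measurable_completion) measurable
      show "AE x in lebesgue. f x * gauss_sin_kernel x y = f' x * gauss_sin_kernel x y"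
        using AE_completion[OF ae(1)] by eventually_elim simp
    qed
    also have "\<dots> = h y"
      unfolding h_def by (rule integral_completion) measurable
    finally show ?thesis .
  qed
  have int: "integrable lborel2 (\<lambda>(x, y). f' x * g' y * gauss_sin_kernel x y)"
    by (rule integrable_kernel_form[OF m b])
  have "gauss_sin_form f g = (LINT y|lebesgue. g y * (LINT x|lebesgue. f x * gauss_sin_kernel x y))"
    unfolding gauss_sin_form_def integral_mult_right_zero[symmetric]
    by (simp add: gauss_sin_kernel_def gauss_def add_divide_distrib exp_add[of "- (_ / 2)" "- (_ / 2)", simplified] mult_ac)
  also have "\<dots> = (LINT y|lebesgue. g' y * h y)"
    unfolding inner
  proof (rule integral_cong_AE)
    show "(\<lambda>y. g y * h y) \<in> borel_measurable lebesgue"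
      by (intro borel_measurable_times g measurable_completion) simp
    show "(\<lambda>y. g' y * h y) \<in> borel_measurable lebesgue"
      by (intro measurable_completion) measurable
    show "AE y in lebesgue. g y * h y = g' y * h y"
      using AE_completion[OF ae(2)] by eventually_elim simp
  qed
  also have "\<dots> = (LINT y|lborel. g' y * h y)"
    by (rule integral_completion) measurable
  also have "\<dots> = (LINT y|lborel. LINT x|lborel. f' x * g' y * gauss_sin_kernel x y)"
    unfolding h_def integral_mult_right_zero[symmetric] by (simp add: mult_ac)
  also have "\<dots> = kernel_form f' g'"
    unfolding kernel_form_def using int by (rule lborel_pair.integral_snd)
  finally show ?thesis .
qed

lemma sign_valued_borel_representative:
  fixes f :: "real \<Rightarrow> real"
  assumes "f \<in> borel_measurable lebesgue" and f: "\<And>x. f x \<in> {-1, 1}"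
  obtains f' where "f' \<in> borel_measurable borel" "\<And>x. f' x \<in> {-1, 1}" "AE x in lborel. f x = f' x"
proof -
  obtain h where [measurable]: "h \<in> borel_measurable lborel" and h: "AE x in lborel. f x = h x"
    using completion_ex_borel_measurable_real[OF assms(1)] by auto
  \<comment> \<open>A Borel version \<open>h\<close> may take other values on a null set;
    thresholding forces the values 1 and -1 everywhere and changes nothing where \<open>h\<close>
    agrees with \<open>f\<close>.\<close>
  let ?f' = "\<lambda>x. if 0 < h x then 1 else - 1 :: real"
  show ?thesis
  proof (rule that)
    show "?f' \<in> borel_measurable borel" by measurable
    show "AE x in lborel. f x = ?f' x"
      using h
    proof eventually_elim
      case (elim x)
      then show ?case using f[of x] by auto
    qed
  qed auto
qed

theorem theorem1p3:
  fixes f g :: "real \<Rightarrow> real"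
  assumes "f \<in> borel_measurable lebesgue" and "\<And>x. f x \<in> {-1, 1}"
    and "g \<in> borel_measurable lebesgue" and "\<And>x. g x \<in> {-1, 1}"
  shows "gauss_sin_form f g \<le> gauss_sin_form sgn sgn \<and>
         gauss_sin_form sgn sgn = 2 * sqrt 2 * ln (1 + sqrt 2) \<and>
         (gauss_sin_form f g = 2 * sqrt 2 * ln (1 + sqrt 2) \<longrightarrow>
           (AE x in lebesgue. f x = sgn x \<and> g x = sgn x) \<or>
           (AE x in lebesgue. f x = - sgn x \<and> g x = - sgn x))"
proof -
  obtain f' where f': "f' \<in> borel_measurable borel" "\<And>x. f' x \<in> {-1, 1}" "AE x in lborel. f x = f' x"
    using sign_valued_borel_representative[OF assms(1,2)] by blast
  obtain g' where g': "g' \<in> borel_measurable borel" "\<And>x. g' x \<in> {-1, 1}" "AE x in lborel. g x = g' x"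
    using sign_valued_borel_representative[OF assms(3,4)] by blast
  have "\<bar>f' x\<bar> \<le> 1" "\<bar>g' x\<bar> \<le> 1" for x
    using f'(2)[of x] g'(2)[of x] by auto
  then have form: "gauss_sin_form f g = kernel_form f' g'"
    by (intro gauss_sin_form_eq_kernel_form assms f' g')
  \<comment> \<open>\<open>sgn\<close> takes the value 0 at the origin, so it is treated directly
    through the bound by 1 and not as a function with values in {-1, 1}.\<close>
  have sgn: "gauss_sin_form sgn sgn = total_weight"
    unfolding kernel_form_sgn_sgn[symmetric]
    by (rule gauss_sin_form_eq_kernel_form) (auto simp: sgn_if intro!: measurable_completion)
  have "(AE x in lebesgue. f x = sgn x \<and> g x = sgn x) \<or> (AE x in lebesgue. f x = - sgn x \<and> g x = - sgn x)"
    if "gauss_sin_form f g = total_weight"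
  proof -
    have c: "sgn_coeff f' = sgn_coeff g'" "sgn_coeff f' \<in> {-1, 1}"
      using kernel_form_bound(2)[OF f'(1) g'(1) f'(2) g'(2)] that form by auto
    \<comment> \<open>Both functions carry the same coefficient, so a single choice of sign serves
      \<open>f\<close> and \<open>g\<close>.\<close>
    have "AE x in lborel. f' x = sgn_coeff f' * sgn x" "AE x in lborel. g' x = sgn_coeff f' * sgn x"
      using AE_eq_sgn_of_sgn_coeff[OF f'(1,2)] AE_eq_sgn_of_sgn_coeff[OF g'(1,2)] c by auto
    with f'(3) g'(3) have "AE x in lborel. f x = sgn_coeff f' * sgn x \<and> g x = sgn_coeff f' * sgn x"
      by eventually_elim simp
    then show ?thesis
      using c(2) by (auto dest: AE_completion)
  qed
  then show ?thesis
    using kernel_form_bound(1)[OF f'(1) g'(1) f'(2) g'(2)] form sgn by (simp add: total_weight_eq)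
qed

end
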